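(* Let $n\ge 3$ be odd, let $k\ge 1$ be an integer, and let $c$ be an integer with $1\le c\le k$. Let $G_{n,k,-c}$ be the unicyclic graph consisting of a cycle $C_n$ with vertices $a_1,a_2,\dots,a_n$ (in cyclic order), together with $k$ pendant vertices attached to each of $a_1,\dots,a_{n-1}$ and $k-c$ pendant vertices attached to $a_n$ (so $G_{n,k,-c}$ has $p=q=n(k+1)-c$ vertices and edges). Then $G_{n,k,-c}$ is super edge-magic total and $$sm(G_{n,k,-c})=2n(k+1)-2c+\frac{n+3}{2}.$$
   Context: All graphs are finite, simple and undirected. For a graph $G$ with $p$ vertices and $q$ edges, a super edge-magic total labeling is a bijection $f\colon V(G)\cup E(G)\to\{1,2,\dots,p+q\}$ with $f(V(G))=\{1,\dots,p\}$ such that $f(u)+f(v)+f(uv)$ equals a constant $c(f)$ (the magic constant) for every edge $uv\in E(G)$. $G$ is super edge-magic total if it admits such a labeling, and its super edge-magic total strength $sm(G)$ is the minimum of $c(f)$ over all super edge-magic total labelings $f$ of $G$. *)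

theory Defs
  imports Main
begin

text \<open>An undirected graph is a pair of a vertex set and a set of two-element sets of vertices.\<close>

type_synonym 'a ugraph = "'a set \<times> 'a set set"

abbreviation vertices :: "'a ugraph \<Rightarrow> 'a set" where
  "vertices \<equiv> fst"

abbreviation edges :: "'a ugraph \<Rightarrow> 'a set set" where
  "edges \<equiv> snd"

definition finite_simple_graph :: "'a ugraph \<Rightarrow> bool" where
  "finite_simple_graph G \<longleftrightarrow>
     finite (vertices G) \<and> (\<forall>e\<in>edges G. e \<subseteq> vertices G \<and> card e = 2)"

text \<open>
  A total labeling is a function on the disjoint union of vertices (tagged \<open>Inl\<close>)
  and edges (tagged \<open>Inr\<close>).
\<close>

definition has_magic_constant :: "'a ugraph \<Rightarrow> ('a + 'a set \<Rightarrow> nat) \<Rightarrow> nat \<Rightarrow> bool" where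
  "has_magic_constant G f m \<longleftrightarrow>
     (\<forall>u v. {u, v} \<in> edges G \<longrightarrow> f (Inl u) + f (Inl v) + f (Inr {u, v}) = m)"

definition semt_labeling :: "'a ugraph \<Rightarrow> ('a + 'a set \<Rightarrow> nat) \<Rightarrow> bool" where
  "semt_labeling G f \<longleftrightarrow>
     bij_betw f (vertices G <+> edges G) {1..card (vertices G) + card (edges G)} \<and>
     f ` (Inl ` vertices G) = {1..card (vertices G)} \<and>
     (\<exists>m. has_magic_constant G f m)"

definition super_edge_magic_total :: "'a ugraph \<Rightarrow> bool" where
  "super_edge_magic_total G \<longleftrightarrow> (\<exists>f. semt_labeling G f)"

text \<open>Only meaningful when \<open>super_edge_magic_total G\<close> holds; otherwise \<open>LEAST\<close> is arbitrary.\<close>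

definition semt_strength :: "'a ugraph \<Rightarrow> nat" where
  "semt_strength G = (LEAST m. \<exists>f. semt_labeling G f \<and> has_magic_constant G f m)"

text \<open>
  \<open>Cyc i\<close> is the cycle vertex \<open>a\<^sub>i\<close> and \<open>Pend i j\<close> is the \<open>j\<close>-th pendant vertex at \<open>a\<^sub>i\<close>;
  both indices start from \<open>1\<close>.
\<close>

datatype vertex = Cyc nat | Pend nat nat

definition pendants :: "nat \<Rightarrow> nat \<Rightarrow> nat \<Rightarrow> nat \<Rightarrow> nat" where
  "pendants n k c i = (if i = n then k - c else k)"

text \<open>The successor of \<open>a\<^sub>i\<close> on the cycle is \<open>a\<close> with index \<open>i mod n + 1\<close>, which is \<open>1\<close> for \<open>i = n\<close>.\<close>

definition unicyclic_graph :: "nat \<Rightarrow> nat \<Rightarrow> nat \<Rightarrow> vertex ugraph" where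
  "unicyclic_graph n k c =
     ({Cyc i | i. i \<in> {1..n}} \<union>
      {Pend i j | i j. i \<in> {1..n} \<and> j \<in> {1..pendants n k c i}},
      {{Cyc i, Cyc (i mod n + 1)} | i. i \<in> {1..n}} \<union>
      {{Cyc i, Pend i j} | i j. i \<in> {1..n} \<and> j \<in> {1..pendants n k c i}})"

lemma cycle_succ:
  fixes n i :: nat
  assumes "n \<ge> 3" "i \<in> {1..n}"
  shows "i mod n + 1 = (if i = n then 1 else i + 1)"
  using assms by auto

lemma finite_simple_unicyclic_graph:
  assumes "n \<ge> 3"
  shows "finite_simple_graph (unicyclic_graph n k c)"
proof -
  have "{Pend i j | i j. i \<in> {1..n} \<and> j \<in> {1..pendants n k c i}} =
      (\<lambda>(i, j). Pend i j) ` (SIGMA i:{1..n}. {1..pendants n k c i})"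
    by auto
  then have "finite {Pend i j | i j. i \<in> {1..n} \<and> j \<in> {1..pendants n k c i}}"
    by simp
  then show ?thesis
    using assms cycle_succ[OF assms]
    by (auto simp: finite_simple_graph_def unicyclic_graph_def card_insert_if)
qed

lemma sum_pendants:
  assumes "n \<ge> 1" "c \<le> k"
  shows "(\<Sum>i = 1..n. pendants n k c i) + c = n * k"
proof -
  obtain m where m: "n = Suc m" using assms(1) by (cases n) auto
  have "(\<Sum>i = 1..m. pendants n k c i) = (\<Sum>i = 1..m. k)"
    by (rule sum.cong) (auto simp: pendants_def m)
  then show ?thesis using assms(2) by (simp add: m pendants_def)
qed

lemma card_unicyclic_graph:
  assumes "n \<ge> 3" "c \<le> k"
  shows "card (vertices (unicyclic_graph n k c)) = n * (k + 1) - c"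
    and "card (edges (unicyclic_graph n k c)) = n * (k + 1) - c"
proof -
  let ?S = "SIGMA i:{1..n}. {1..pendants n k c i}"
  have S: "card ?S = n * k - c" "c \<le> n * k"
    using sum_pendants[of n c k] assms by simp_all
  have P: "{Pend i j | i j. i \<in> {1..n} \<and> j \<in> {1..pendants n k c i}} = (\<lambda>(i, j). Pend i j) ` ?S"
    and Q: "{{Cyc i, Pend i j} | i j. i \<in> {1..n} \<and> j \<in> {1..pendants n k c i}} =
      (\<lambda>(i, j). {Cyc i, Pend i j}) ` ?S"
    and C: "{Cyc i | i. i \<in> {1..n}} = Cyc ` {1..n}"
    and D: "{{Cyc i, Cyc (i mod n + 1)} | i. i \<in> {1..n}} =
      (\<lambda>i. {Cyc i, Cyc (i mod n + 1)}) ` {1..n}"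
    by (force simp: image_iff)+
  have "card ((\<lambda>(i, j). Pend i j) ` ?S) = n * k - c"
    by (subst card_image) (auto simp: inj_on_def S(1)[simplified])
  moreover have "card (Cyc ` {1..n}) = n"
    by (subst card_image) (auto simp: inj_on_def)
  ultimately show "card (vertices (unicyclic_graph n k c)) = n * (k + 1) - c"
    unfolding unicyclic_graph_def fst_conv P C
    by (subst card_Un_disjoint) (use S(2) in auto)
  have "card ((\<lambda>(i, j). {Cyc i, Pend i j}) ` ?S) = n * k - c"
    by (subst card_image) (auto simp: inj_on_def doubleton_eq_iff S(1)[simplified])
  moreover have "inj_on (\<lambda>i. {Cyc i, Cyc (i mod n + 1)}) {1..n}"
  proof (rule inj_onI)
    fix i j
    assume "i \<in> {1..n}" "j \<in> {1..n}" "{Cyc i, Cyc (i mod n + 1)} = {Cyc j, Cyc (j mod n + 1)}"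
    then show "i = j"
      using assms(1) unfolding doubleton_eq_iff
      by (simp only: cycle_succ[OF assms(1)] vertex.inject) (auto split: if_splits)
  qed
  then have "card ((\<lambda>i. {Cyc i, Cyc (i mod n + 1)}) ` {1..n}) = n"
    by (subst card_image) auto
  ultimately show "card (edges (unicyclic_graph n k c)) = n * (k + 1) - c"
    unfolding unicyclic_graph_def snd_conv Q D
    by (subst card_Un_disjoint) (use S(2) in \<open>auto simp: doubleton_eq_iff\<close>)
qed

end

theory Submission
  imports Defs
begin

text \<open>
  Index both the vertices and the edges by pairs \<open>(i, j)\<close>: for \<open>j = 0\<close> the edge leads from
  \<open>a\<^sub>i\<close> to its successor, for \<open>j > 0\<close> to its \<open>j\<close>-th pendant vertex. For the upper bound, label the
  cycle so that the vertex sums of consecutive vertices are the \<open>n\<close> consecutive numbers from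
  \<open>(n + 3) / 2\<close> on, the edge from \<open>a\<^sub>n\<close> to \<open>a\<^sub>1\<close> having the smallest sum and \<open>a\<^sub>1\<close> the label \<open>1\<close>. Each
  further row \<open>j\<close> of pendant vertices is a translate of the cycle row, by \<open>n\<close> as long as the rows
  are full; later rows lack exactly the smallest label and the smallest sum, so that translating
  by \<open>n - 1\<close> keeps labels and sums consecutive. For the lower bound, sum the magic constant over
  all edges: the tails \<open>a\<^sub>i\<close> of the edges contribute \<open>k + 1 - c\<close> times the labels of \<open>a\<^sub>1, \<dots>, a\<^sub>n\<close>
  and \<open>c\<close> times those of \<open>a\<^sub>1, \<dots>, a\<^bsub>n-1\<^esub>\<close>, while the heads and the edges themselves run
  through all labels once.
\<close>

section \<open>Sums of distinct positive integers\<close>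

lemma sum_distinct_pos_ge:
  fixes A :: "nat set"
  assumes "finite A" "0 \<notin> A"
  shows "card A * (card A + 1) \<le> 2 * \<Sum>A"
  using assms
proof (induction A rule: finite_linorder_max_induct)
  case (insert b A)
  have "insert b A \<subseteq> {1..b}"
  proof
    fix x assume "x \<in> insert b A"
    then have "x \<noteq> 0" "x \<le> b"
      using insert by (metis, auto)
    then show "x \<in> {1..b}"
      by simp
  qed
  then have "card (insert b A) \<le> card {1..b}"
    by (rule card_mono[rotated]) simp
  moreover have "card (insert b A) = card A + 1" "\<Sum>(insert b A) = b + \<Sum>A"
    using insert by auto
  ultimately show ?case
    using insert by auto
qed simp

lemma sum_inj_pos_ge:
  fixes f :: "'a \<Rightarrow> nat"
  assumes "finite A" "inj_on f A" "\<And>x. x \<in> A \<Longrightarrow> 0 < f x"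
  shows "card A * (card A + 1) \<le> 2 * (\<Sum>x\<in>A. f x)"
  using sum_distinct_pos_ge[of "f ` A"] assms by (force simp: card_image sum.reindex)

section \<open>The graph and its oriented edges\<close>

locale sun =
  fixes n k c :: nat
  assumes n_ge: "3 \<le> n" and odd_n: "odd n" and c_le: "c \<le> k"
begin

abbreviation "G \<equiv> unicyclic_graph n k c"

definition order :: nat where "order = n * (k + 1) - c"

definition ix :: "(nat \<times> nat) set" where
  "ix = (SIGMA i:{1..n}. {0..pendants n k c i})"

text \<open>With the cycle oriented along successors and pendant edges oriented outwards, every
  vertex has exactly one incoming edge. One index set thus serves vertices and edges alike.\<close>

fun head :: "nat \<times> nat \<Rightarrow> vertex" where
  "head (i, j) = (if j = 0 then Cyc (i mod n + 1) else Pend i j)"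

definition edge :: "nat \<times> nat \<Rightarrow> vertex set" where
  "edge x = {Cyc (fst x), head x}"

lemma order_eq: "order + c = n * (k + 1)"
proof -
  have "c \<le> n * k"
    using c_le n_ge by (intro order_trans[OF c_le]) simp
  then show ?thesis
    unfolding order_def by simp
qed

lemma finite_ix [simp]: "finite ix"
  unfolding ix_def by simp

lemma card_ix: "card ix = order"
proof -
  have "card ix = (\<Sum>i = 1..n. pendants n k c i) + n"
    unfolding ix_def by (simp add: sum_Suc)
  then show ?thesis
    using sum_pendants[of n c k] order_eq n_ge c_le by simp
qed

lemma card_vertices: "card (vertices G) = order" and card_edges: "card (edges G) = order"
  using card_unicyclic_graph[OF n_ge c_le] by (simp_all add: order_def)

lemma head_image: "head ` ix = vertices G"
proof (intro equalityI subsetI)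
  fix v assume "v \<in> vertices G"
  then consider i where "v = Cyc i" "i \<in> {1..n}"
    | i j where "v = Pend i j" "i \<in> {1..n}" "j \<in> {1..pendants n k c i}"
    unfolding unicyclic_graph_def by auto
  then show "v \<in> head ` ix"
  proof cases
    case 1
    then have "v = head (if i = 1 then n else i - 1, 0)"
      by auto
    moreover have "(if i = 1 then n else i - 1, 0) \<in> ix"
      using 1 by (auto simp: ix_def)
    ultimately show ?thesis by blast
  next
    case 2
    then have "v = head (i, j)" "(i, j) \<in> ix"
      by (auto simp: ix_def)
    then show ?thesis by blast
  qed
next
  fix v assume "v \<in> head ` ix"
  then show "v \<in> vertices G"
    using n_ge by (fastforce simp: unicyclic_graph_def ix_def Suc_le_eq)
qed

lemma edge_image: "edge ` ix = edges G"
proof (intro equalityI subsetI)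
  fix e assume "e \<in> edges G"
  then consider i where "e = {Cyc i, Cyc (i mod n + 1)}" "i \<in> {1..n}"
    | i j where "e = {Cyc i, Pend i j}" "i \<in> {1..n}" "j \<in> {1..pendants n k c i}"
    unfolding unicyclic_graph_def by auto
  then show "e \<in> edge ` ix"
  proof cases
    case 1
    then have "e = edge (i, 0)" "(i, 0) \<in> ix"
      by (auto simp: ix_def edge_def)
    then show ?thesis by blast
  next
    case 2
    then have "e = edge (i, j)" "(i, j) \<in> ix"
      by (auto simp: ix_def edge_def)
    then show ?thesis by blast
  qed
next
  fix e assume "e \<in> edge ` ix"
  then show "e \<in> edges G"
    by (fastforce simp: unicyclic_graph_def ix_def edge_def Suc_le_eq)
qed

lemma bij_head: "bij_betw head ix (vertices G)"
  unfolding bij_betw_def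
  by (auto simp: head_image card_vertices card_ix intro!: eq_card_imp_inj_on)

lemma bij_edge: "bij_betw edge ix (edges G)"
  unfolding bij_betw_def
  by (auto simp: edge_image card_edges card_ix intro!: eq_card_imp_inj_on)

lemma head_neq: "(i, j) \<in> ix \<Longrightarrow> Cyc i \<noteq> head (i, j)"
  using n_ge by (cases "i = n") (auto simp: ix_def)

section \<open>Translating the rows so that values stay consecutive\<close>

text \<open>The truncated difference \<open>j - (k - c)\<close> is the number of rows before or at \<open>j\<close> lacking the
  index \<open>i = n\<close>.\<close>

definition shift :: "nat \<Rightarrow> nat" where
  "shift j = j * n - (j - (k - c))"

lemma shift_eq: "shift j + (j - (k - c)) = j * n"
proof -
  have "j - (k - c) \<le> j * n"
    using n_ge by (intro order_trans[OF diff_le_self]) simp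
  then show ?thesis
    unfolding shift_def by (rule le_add_diff_inverse2)
qed

text \<open>Row \<open>Suc j\<close> contains the index \<open>n\<close> exactly when
  \<open>j < k - c\<close>. A row without it starts one value later, hence the smaller step.\<close>

lemma shift_Suc: "shift (Suc j) = shift j + (if j < k - c then n else n - 1)"
  using shift_eq[of j] shift_eq[of "Suc j"] n_ge by (auto simp: Suc_diff_le not_less)

lemma shift_less:
  assumes "j < j'"
  shows "shift j + (if j' \<le> k - c then n else n - 1) \<le> shift j'"
proof -
  obtain d where "j' = Suc (j + d)"
    using less_imp_Suc_add assms by blast
  moreover have "shift j + (if Suc (j + d) \<le> k - c then n else n - 1) \<le> shift (Suc (j + d))"
    by (induction d) (use n_ge in \<open>auto simp: shift_Suc split: if_splits\<close>)
  ultimately show ?thesis by simp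
qed

text \<open>Used twice: with \<open>\<phi>\<close> the cycle label of the successor, for the vertex
  labels, and with \<open>\<phi>\<close> the successor itself, for the vertex sums of the edges. The
  condition \<open>\<phi> n = 1\<close> gives the smallest value to the index that short rows
  lack.\<close>

lemma shift_image:
  assumes bij: "bij_betw \<phi> {1..n} {1..n}" and last: "\<phi> n = 1"
  shows "(\<lambda>(i, j). shift j + \<phi> i) ` ix = {1..order}"
proof -
  let ?F = "\<lambda>(i, j). shift j + \<phi> i"
  have range: "1 \<le> \<phi> i" "\<phi> i \<le> n" if "i \<in> {1..n}" for i
    using bij that by (auto dest: bij_betwE)
  have inj: "i = i'" if "\<phi> i = \<phi> i'" "i \<in> {1..n}" "i' \<in> {1..n}" for i i'
    using bij that by (auto simp: bij_betw_def dest: inj_onD)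
  \<comment> \<open>In a row without the index \<open>n\<close> the values start at 2, which makes
    up for a translation by only \<open>n - 1\<close>.\<close>
  have ge2: "2 \<le> \<phi> i" if "i \<in> {1..n}" "i \<noteq> n" for i
    using range(1)[of i] inj[of i n] that last n_ge by fastforce
  have less: "?F (i, j) < ?F (i', j')" if "(i, j) \<in> ix" "(i', j') \<in> ix" "j < j'" for i j i' j'
  proof (cases "j' \<le> k - c")
    case True
    then show ?thesis
      using shift_less[OF that(3)] range[of i] range[of i'] that n_ge by (auto simp: ix_def)
  next
    case False
    then have "i' \<noteq> n"
      using that by (auto simp: ix_def pendants_def)
    then show ?thesis
      using shift_less[OF that(3)] range[of i] ge2[of i'] that n_ge False by (auto simp: ix_def)
  qed
  have "inj_on ?F ix"
  proof (rule inj_onI, clarsimp)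
    fix i j i' j' assume *: "(i, j) \<in> ix" "(i', j') \<in> ix" "shift j + \<phi> i = shift j' + \<phi> i'"
    then have "j = j'"
      using less[of i j i' j'] less[of i' j' i j] by (cases j j' rule: linorder_cases) auto
    then show "i = i' \<and> j = j'"
      using * inj[of i i'] by (auto simp: ix_def)
  qed
  moreover have "?F ` ix \<subseteq> {1..order}"
  proof clarsimp
    fix i j assume "(i, j) \<in> ix"
    then have "j \<le> k" "1 \<le> \<phi> i" "\<phi> i \<le> n"
      using range[of i] by (auto simp: ix_def pendants_def split: if_splits)
    moreover have "shift j \<le> shift k"
      using \<open>j \<le> k\<close> shift_less[of j k] by (cases "j = k") auto
    moreover have "shift k + n = order"
      using shift_eq[of k] order_eq c_le by (simp add: algebra_simps)
    ultimately show "Suc 0 \<le> shift j + \<phi> i \<and> shift j + \<phi> i \<le> order"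
      by simp
  qed
  ultimately show ?thesis
    by (intro card_subset_eq) (auto simp: card_image card_ix)
qed

section \<open>Vertex labels\<close>

text \<open>The classical labeling of an odd cycle: odd indices take the labels up to
  \<open>(n + 1) div 2\<close> in order, even indices the remaining ones.\<close>

definition cyc_label :: "nat \<Rightarrow> nat" where
  "cyc_label i = (if odd i then (i + 1) div 2 else (n + i + 1) div 2)"

text \<open>A pendant vertex at \<open>Cyc i\<close> copies the label of the successor of
  \<open>Cyc i\<close> up to \<open>shift j\<close>, so the vertex sum of its edge is that of the
  cycle edge leaving \<open>Cyc i\<close>, moved by \<open>shift j\<close>.\<close>

fun label :: "vertex \<Rightarrow> nat" where
  "label (Cyc i) = cyc_label i"
| "label (Pend i j) = shift j + cyc_label (i mod n + 1)"

lemma cyc_label_sum: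
  assumes "i \<in> {1..n}"
  shows "cyc_label i + cyc_label (i mod n + 1) = (n + 3) div 2 + i mod n"
proof (cases "i = n")
  case True
  then show ?thesis
    using odd_n by (auto simp: cyc_label_def elim!: oddE)
next
  case False
  then have "i mod n = i"
    using assms by simp
  then show ?thesis
    using odd_n by (cases "odd i") (auto simp: cyc_label_def elim!: oddE evenE)
qed

lemma bij_cyc_label: "bij_betw cyc_label {1..n} {1..n}"
proof -
  have "inj_on cyc_label {1..n}"
    using odd_n by (intro inj_onI) (auto simp: cyc_label_def elim!: oddE evenE split: if_splits)
  moreover have "cyc_label ` {1..n} \<subseteq> {1..n}"
    using odd_n by (auto simp: cyc_label_def elim!: oddE evenE)
  ultimately show ?thesis
    by (metis bij_betw_def endo_inj_surj finite_atLeastAtMost)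
qed

lemma bij_succ: "bij_betw (\<lambda>i. i mod n + 1) {1..n} {1..n}"
proof -
  have "inj_on (\<lambda>i. i mod n + 1) {1..n}"
    by (intro inj_onI) (metis add_right_cancel atLeastAtMost_iff le_neq_implies_less mod_less
        mod_self not_one_le_zero)
  moreover have "(\<lambda>i. i mod n + 1) ` {1..n} \<subseteq> {1..n}"
    using n_ge by (auto simp: Suc_le_eq)
  ultimately show ?thesis
    by (metis bij_betw_def endo_inj_surj finite_atLeastAtMost)
qed

text \<open>\<open>shift 0 = 0\<close> merges the cycle case and the pendant case.\<close>

lemma label_head: "label (head (i, j)) = shift j + cyc_label (i mod n + 1)"
  by (simp add: shift_def)

lemma label_image: "label ` vertices G = {1..order}"
proof -
  have "label ` vertices G = (\<lambda>(i, j). shift j + (cyc_label \<circ> (\<lambda>i. i mod n + 1)) i) ` ix"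
    unfolding head_image[symmetric] image_image
    by (intro image_cong) (auto simp: label_head simp del: head.simps)
  also have "\<dots> = {1..order}"
    by (intro shift_image bij_betw_trans[OF bij_succ bij_cyc_label]) (simp add: cyc_label_def)
  finally show ?thesis .
qed

lemma sum_label_edge:
  assumes "(i, j) \<in> ix"
  shows "(\<Sum>v\<in>edge (i, j). label v) = (n + 3) div 2 + (shift j + i mod n)"
  using head_neq[OF assms] cyc_label_sum[of i] assms
  by (simp add: edge_def label_head ix_def del: head.simps)

section \<open>Edge labels and the upper bound\<close>

text \<open>The smallest vertex sum, \<open>(n + 3) div 2\<close>, meets the largest edge label,
  \<open>2 * order\<close>.\<close>

definition magic :: nat where "magic = 2 * order + (n + 3) div 2"

definition total_label :: "vertex + vertex set \<Rightarrow> nat" where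
  "total_label = case_sum label (\<lambda>e. magic - (\<Sum>v\<in>e. label v))"

lemma row_image: "(\<lambda>(i, j). shift j + (i mod n + 1)) ` ix = {1..order}"
  by (intro shift_image bij_succ) simp

lemma edge_label_image: "(\<lambda>e. total_label (Inr e)) ` edges G = {order + 1..2 * order}"
proof -
  have "(\<lambda>e. total_label (Inr e)) ` edges G = (\<lambda>x. total_label (Inr (edge x))) ` ix"
    unfolding edge_image[symmetric] image_image ..
  \<comment> \<open>The edge with the \<open>x\<close>-th smallest vertex sum receives the
    \<open>x\<close>-th largest label.\<close>
  also have "\<dots> = (\<lambda>x. 2 * order + 1 - x) ` (\<lambda>(i, j). shift j + (i mod n + 1)) ` ix"
    unfolding image_image
    by (intro image_cong) (auto simp: total_label_def sum_label_edge magic_def)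
  also have "\<dots> = (\<lambda>x. 2 * order + 1 - x) ` {1..order}"
    unfolding row_image ..
  also have "\<dots> = {order + 1..2 * order}"
  proof (intro equalityI subsetI)
    fix y assume "y \<in> {order + 1..2 * order}"
    then have "y = 2 * order + 1 - (2 * order + 1 - y)" "2 * order + 1 - y \<in> {1..order}"
      by auto
    then show "y \<in> (\<lambda>x. 2 * order + 1 - x) ` {1..order}"
      by (rule image_eqI)
  qed auto
  finally show ?thesis .
qed

lemma magic_total_label: "has_magic_constant G total_label magic"
  unfolding has_magic_constant_def
proof (intro allI impI)
  fix u v assume "{u, v} \<in> edges G"
  then obtain i j where ij: "(i, j) \<in> ix" "{u, v} = edge (i, j)"
    unfolding edge_image[symmetric] by auto
  have "u \<noteq> v"
    using ij head_neq[OF ij(1)] by (auto simp: edge_def doubleton_eq_iff simp del: head.simps)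
  then have "label u + label v = (n + 3) div 2 + (shift j + i mod n)"
    using sum_label_edge[OF ij(1)] unfolding ij(2)[symmetric] by simp
  \<comment> \<open>This bound keeps the vertex sum below \<open>magic\<close>, so the truncated
    subtraction in \<open>total_label\<close> is exact.\<close>
  moreover have "shift j + (i mod n + 1) \<in> {1..order}"
    unfolding row_image[symmetric] using ij(1) by force
  ultimately show "total_label (Inl u) + total_label (Inl v) + total_label (Inr {u, v}) = magic"
    using \<open>u \<noteq> v\<close> by (simp add: total_label_def magic_def)
qed

lemma semt_total_label: "semt_labeling G total_label"
proof -
  have fin: "finite (vertices G)" "finite (edges G)"
    by (simp_all flip: head_image edge_image)
  have V: "total_label ` Inl ` vertices G = {1..order}"
    unfolding image_image using label_image by (simp add: total_label_def)
  have "total_label ` (vertices G <+> edges G) = {1..order} \<union> {order + 1..2 * order}"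
    unfolding Plus_def image_Un V using edge_label_image by (simp add: image_image)
  also have "\<dots> = {1..2 * order}"
    by auto
  finally have "total_label ` (vertices G <+> edges G) = {1..2 * order}" .
  moreover from this have "inj_on total_label (vertices G <+> edges G)"
    using fin by (intro eq_card_imp_inj_on) (auto simp: card_Plus card_vertices card_edges)
  ultimately show ?thesis
    unfolding semt_labeling_def bij_betw_def
    using V magic_total_label by (auto simp: card_vertices card_edges mult_2)
qed

section \<open>Lower bound for the magic constant\<close>

lemma magic_le:
  assumes f: "semt_labeling G f" and m: "has_magic_constant G f m"
  shows "magic \<le> m"
proof -
  define x where "x i = f (Inl (Cyc i))" for i
  have bij: "bij_betw f (vertices G <+> edges G) {1..2 * order}"
    using f by (simp add: semt_labeling_def card_vertices card_edges mult_2)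
  have fin: "finite (vertices G)" "finite (edges G)"
    by (simp_all flip: head_image edge_image)
  have cyc: "Cyc i \<in> vertices G" if "i \<in> {1..n}" for i
    using that by (simp add: unicyclic_graph_def)
  have inj: "inj_on x {1..n}"
  proof (rule inj_onI)
    fix i j assume "i \<in> {1..n}" "j \<in> {1..n}" "x i = x j"
    then show "i = j"
      using inj_onD[OF bij_betw_imp_inj_on[OF bij] _ InlI InlI, OF _ cyc cyc, of i j]
      by (simp add: x_def)
  qed
  have x_pos: "0 < x i" if "i \<in> {1..n}" for i
    using bij_betw_apply[OF bij InlI, OF cyc, OF that] by (simp add: x_def)
  have full: "n * (n + 1) \<le> 2 * (\<Sum>i = 1..n. x i)"
    using sum_inj_pos_ge[OF _ inj x_pos] by simp
  \<comment> \<open>\<open>Cyc n\<close> is the tail of \<open>c\<close> fewer edges than the other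
    cycle vertices, so the sum over those others needs a bound of its own.\<close>
  have "inj_on x {1..<n}"
    using inj by (rule inj_on_subset) auto
  then have part: "(n - 1) * n \<le> 2 * (\<Sum>i = 1..<n. x i)"
    using sum_inj_pos_ge[of "{1..<n}" x] x_pos n_ge by simp
  have range_eq: "{1..n} = insert n {1..<n}"
    using n_ge by auto
  have split: "(\<Sum>i = 1..n. x i) = (\<Sum>i = 1..<n. x i) + x n"
    unfolding range_eq by simp
  obtain d where d: "k = c + d"
    using c_le le_Suc_ex by blast
  have tails: "(\<Sum>(i, j)\<in>ix. x i) = (k + 1 - c) * (\<Sum>i = 1..n. x i) + c * (\<Sum>i = 1..<n. x i)"
  proof -
    have "(\<Sum>(i, j)\<in>ix. x i) = (\<Sum>i = 1..n. (pendants n k c i + 1) * x i)"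
      unfolding ix_def by (subst sum.Sigma[symmetric]) auto
    also have "\<dots> = (\<Sum>i = 1..<n. (pendants n k c i + 1) * x i) + (k - c + 1) * x n"
      unfolding range_eq by (simp add: pendants_def)
    also have "(\<Sum>i = 1..<n. (pendants n k c i + 1) * x i) = (k + 1) * (\<Sum>i = 1..<n. x i)"
      unfolding sum_distrib_left by (intro sum.cong) (auto simp: pendants_def)
    finally show ?thesis
      unfolding split by (simp add: d algebra_simps)
  qed
  have "order * m = (\<Sum>y\<in>ix. f (Inl (Cyc (fst y))) + f (Inl (head y)) + f (Inr (edge y)))"
  proof -
    have "f (Inl (Cyc (fst y))) + f (Inl (head y)) + f (Inr (edge y)) = m" if "y \<in> ix" for y
      using m imageI[OF that, of edge] unfolding edge_image has_magic_constant_def edge_def by blast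
    then show ?thesis by (simp add: card_ix)
  qed
  also have "\<dots> = (\<Sum>(i, j)\<in>ix. x i) + ((\<Sum>v\<in>vertices G. f (Inl v)) + (\<Sum>e\<in>edges G. f (Inr e)))"
    unfolding sum.reindex_bij_betw[OF bij_head, symmetric]
      sum.reindex_bij_betw[OF bij_edge, symmetric]
    by (simp add: sum.distrib x_def case_prod_unfold)
  also have "(\<Sum>v\<in>vertices G. f (Inl v)) + (\<Sum>e\<in>edges G. f (Inr e)) = (\<Sum>z\<in>vertices G <+> edges G. f z)"
    using fin by (simp add: sum.Plus)
  also have "\<dots> = \<Sum>{1..2 * order}"
    using sum.reindex_bij_betw[OF bij, of "\<lambda>z. z"] .
  also have "\<dots> = order * (2 * order + 1)"
    using gauss_sum_from_Suc_0[where ?'a = nat, of "2 * order"] by simp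
  finally have count: "order * m =
      (k + 1 - c) * (\<Sum>i = 1..n. x i) + c * (\<Sum>i = 1..<n. x i) + order * (2 * order + 1)"
    unfolding tails .
  obtain h where h: "n = 2 * h + 1"
    using odd_n by (auto elim: oddE)
  have "(k + 1 - c) * (n * (n + 1)) + c * ((n - 1) * n)
      \<le> (k + 1 - c) * (2 * (\<Sum>i = 1..n. x i)) + c * (2 * (\<Sum>i = 1..<n. x i))"
    using full part by (intro add_mono mult_left_mono) auto
  then have "(k + 1 - c) * n * (h + 1) + c * (h * n) + order * (2 * order + 1) \<le> order * m"
    unfolding count by (simp add: h algebra_simps)
  \<comment> \<open>Since \<open>n = 2 * h + 1\<close>, the factor \<open>2 * order + h + 1\<close>
    is \<open>magic - 1\<close>: a strict inequality here suffices by integrality.\<close>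
  moreover have "order * (2 * order + h + 1)
      < (k + 1 - c) * n * (h + 1) + c * (h * n) + order * (2 * order + 1)"
  proof -
    have "order + c = n * (c + d + 1)"
      using order_eq by (simp add: d)
    then have o: "order = 2 * h * c + n * (d + 1)"
      by (simp add: h algebra_simps)
    \<comment> \<open>The right side exceeds the left by \<open>(d + 1) * n + c * h\<close>.\<close>
    have "order * h < (d + 1) * n * (h + 1) + c * (h * n)"
      unfolding o by (simp add: h algebra_simps)
    then show ?thesis
      by (simp add: d algebra_simps)
  qed
  ultimately have "order * (2 * order + h + 1) < order * m"
    by linarith
  then have "2 * order + h + 1 < m"
    by (simp only: mult_less_cancel1)
  then show ?thesis
    unfolding magic_def using h by simp
qed

end

theorem theorem3p1:
  fixes n k c :: nat
  assumes "n \<ge> 3" and "odd n" and "k \<ge> 1" and "1 \<le> c" and "c \<le> k"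
  shows "super_edge_magic_total (unicyclic_graph n k c) \<and>
         semt_strength (unicyclic_graph n k c) = 2 * n * (k + 1) - 2 * c + (n + 3) div 2"
proof -
  interpret sun n k c
    using assms by unfold_locales
  have "semt_strength G = magic"
    unfolding semt_strength_def
    using semt_total_label magic_total_label magic_le by (intro Least_equality) auto
  also have "magic = 2 * n * (k + 1) - 2 * c + (n + 3) div 2"
    by (simp add: magic_def order_def diff_mult_distrib2 algebra_simps)
  finally show ?thesis
    using semt_total_label unfolding super_edge_magic_total_def by blast
qed

end
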